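(* Let $\mathfrak A$ be an HTM and $\mu$ be an $\mathfrak A$-valued premeasure. Then $\Sigma_{\mathfrak A}(\mu)\subset\mathcal L_{\mathfrak A}(\mu)$. If $\mathfrak A$ is regular, then $\Sigma_{\mathfrak A}(\mu)=\mathcal L_{\mathfrak A}(\mu)$.
   Context: Monoids are Abelian and written additively. An HTM is a monoid with a Hausdorff topology making addition continuous; it is regular if each of its points has a base of neighbourhoods consisting of closed sets. For a map $f$, $D_f$ denotes its domain. "Countable" includes finite and empty. A ring (of sets) is a nonempty set $\mathcal Q$ of sets such that $A\cup B\in\mathcal Q$ and $A\setminus B\in\mathcal Q$ for all $A,B\in\mathcal Q$. A $\delta$-ring is a ring closed under intersections of nonempty countable families; a $\sigma$-ring is a ring closed under countable unions. For a set of sets $\mathcal K$, $\sigma(\mathcal K)$ is the smallest $\sigma$-ring containing $\mathcal K$. A family $\mathbf A\colon I\to\mathcal Q$ is disjoint if $\mathbf A(i)\cap\mathbf A(j)=\varnothing$ for $i\ne j$; it is a partition of $A$ (into elements of $\mathcal Q$) if it is disjoint and $\bigcup_{i\in I}\mathbf A(i)=A$ (members may be empty and $I$ may be empty); it is countable if $I$ is countable. A family $f\colon I\to\mathfrak A$ is summable in $\mathfrak A$ if the net $J\mapsto\sum_{i\in J}f(i)$ over the finite subsets $J\subset I$, directed by inclusion, converges in $\mathfrak A$; its limit is denoted $\sum f$. An $\mathfrak A$-valued premeasure is a map $\mu\colon D_\mu\to\mathfrak A$ whose domain $D_\mu$ is a $\delta$-ring and such that for every $A\in D_\mu$ and every countable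 partition $\mathbf A$ of $A$ into elements of $D_\mu$, the family $\mu\circ\mathbf A$ is summable in $\mathfrak A$ and $\mu(A)=\sum\mu\circ\mathbf A$. The host $\sigma$-ring of a map $\mu$ is $\mathscr H[\mu]=\sigma(D_\mu)$. Maps $\mu,\nu$ are similar, $\mu\asymp\nu$, if $\mathscr H[\mu]=\mathscr H[\nu]$ and $\mu,\nu$ coincide on $D_\mu\cap D_\nu$. An $\mathfrak A$-valued measure is an $\mathfrak A$-valued premeasure $\mu$ which is an extension of every $\mathfrak A$-valued premeasure $\nu$ with $\nu\asymp\mu$. For every $\mathfrak A$-valued premeasure $\mu$ there is a unique $\mathfrak A$-valued measure similar to $\mu$; it is denoted $[\![\mu]\!]_{\mathfrak A}$, and its domain is denoted $\Sigma_{\mathfrak A}(\mu)$. $\mathcal L_{\mathfrak A}(\mu)$ is the set of all $A\in\mathscr H[\mu]$ such that the family $\mu\circ\mathbf A$ is summable in $\mathfrak A$ for every countable disjoint family $\mathbf A\colon I\to D_\mu$ with $\mathbf A(i)\subset A$ for all $i\in I$. *)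

theory Defs
  imports "HOL-Analysis.Analysis"
begin

text \<open>
  A Hausdorff topological monoid is a type of sort
  \<open>{topological_comm_monoid_add, t2_space}\<close>. A map \<open>\<mu>\<close> defined on a set of sets \<open>D\<^sub>\<mu>\<close> is a
  partial function with \<open>dom \<mu> = D\<^sub>\<mu>\<close>, so that ``extension of'' is \<open>\<subseteq>\<^sub>m\<close> and maps with
  the same domain and values are equal.

  Countable families are indexed by arbitrary subsets of \<open>nat\<close> (finite and empty ones
  included). This is no restriction: every countable index set is in bijection with such a
  subset, and disjointness, unions and unordered sums are invariant under reindexing.
\<close>

text \<open>
  In \<^term>\<open>ring_of_sets UNIV Q\<close> the membership \<open>{} \<in> Q\<close> replaces nonemptiness of \<open>Q\<close>; given
  closure under differences the two are equivalent.
\<close>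

definition delta_ring :: "'x set set \<Rightarrow> bool" where
  "delta_ring Q \<longleftrightarrow> ring_of_sets UNIV Q \<and>
     (\<forall>C. C \<subseteq> Q \<and> C \<noteq> {} \<and> countable C \<longrightarrow> \<Inter>C \<in> Q)"

definition sigma_ring :: "'x set set \<Rightarrow> bool" where
  "sigma_ring Q \<longleftrightarrow> ring_of_sets UNIV Q \<and>
     (\<forall>C. C \<subseteq> Q \<and> countable C \<longrightarrow> \<Union>C \<in> Q)"

definition premeasure ::
    "('x set \<rightharpoonup> 'a::{topological_comm_monoid_add, t2_space}) \<Rightarrow> bool" where
  "premeasure \<mu> \<longleftrightarrow> delta_ring (dom \<mu>) \<and>
     (\<forall>A\<in>dom \<mu>. \<forall>(I::nat set) F.
        F ` I \<subseteq> dom \<mu> \<and> disjoint_family_on F I \<and> (\<Union>i\<in>I. F i) = A \<longrightarrow>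
        ((\<lambda>i. the (\<mu> (F i))) has_sum the (\<mu> A)) I)"

definition host :: "('x set \<rightharpoonup> 'a) \<Rightarrow> 'x set set" where
  "host \<mu> = sigma_ring hull (dom \<mu>)"

definition similar :: "('x set \<rightharpoonup> 'a) \<Rightarrow> ('x set \<rightharpoonup> 'a) \<Rightarrow> bool" (infix "\<asymp>" 50) where
  "\<mu> \<asymp> \<nu> \<longleftrightarrow> host \<mu> = host \<nu> \<and> (\<forall>A \<in> dom \<mu> \<inter> dom \<nu>. \<mu> A = \<nu> A)"

definition max_measure ::
    "('x set \<rightharpoonup> 'a::{topological_comm_monoid_add, t2_space}) \<Rightarrow> bool" where
  "max_measure \<mu> \<longleftrightarrow> premeasure \<mu> \<and> (\<forall>\<nu>. premeasure \<nu> \<and> \<nu> \<asymp> \<mu> \<longrightarrow> \<nu> \<subseteq>\<^sub>m \<mu>)"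

text \<open>
  Measures in the present sense are called \<open>max_measure\<close>, since \<^const>\<open>measure\<close> is taken.
  The description below is well defined when \<open>\<mu>\<close> is a premeasure: then exactly one measure
  is similar to \<open>\<mu>\<close>.
\<close>

definition measure_gen ::
    "('x set \<rightharpoonup> 'a::{topological_comm_monoid_add, t2_space}) \<Rightarrow> ('x set \<rightharpoonup> 'a)" where
  "measure_gen \<mu> = (THE \<nu>. max_measure \<nu> \<and> \<nu> \<asymp> \<mu>)"

definition Sigma_dom ::
    "('x set \<rightharpoonup> 'a::{topological_comm_monoid_add, t2_space}) \<Rightarrow> 'x set set" where
  "Sigma_dom \<mu> = dom (measure_gen \<mu>)"

definition L_dom ::
    "('x set \<rightharpoonup> 'a::{topological_comm_monoid_add, t2_space}) \<Rightarrow> 'x set set" where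
  "L_dom \<mu> = {A \<in> host \<mu>. \<forall>(I::nat set) F.
     F ` I \<subseteq> dom \<mu> \<and> disjoint_family_on F I \<and> (\<forall>i\<in>I. F i \<subseteq> A) \<longrightarrow>
     (\<lambda>i. the (\<mu> (F i))) summable_on I}"

end

theory Submission imports Defs begin

text \<open>
  Let \<open>H\<close> be the host of \<open>\<mu>\<close>. Every \<open>A \<in> H\<close> is a disjoint union of sets \<open>G n \<in> dom \<mu>\<close>, and
  \<open>B \<inter> G n \<in> dom \<mu>\<close> for \<open>B \<in> H\<close>. Hence a countably additive \<open>m\<close> on the \<open>H\<close>-subsets of \<open>A\<close>
  which agrees with \<open>\<mu>\<close> is unique: \<open>m B\<close> is the sum of the \<open>\<mu> (B \<inter> G n)\<close>. The domain of the
  largest premeasure similar to \<open>\<mu>\<close> consists of the \<open>A\<close> for which such an \<open>m\<close> exists. Summability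
  of \<open>\<mu>\<close> over disjoint families inside \<open>A\<close> is thus necessary; if the monoid is regular, an
  unordered double sum may be evaluated by rows or by columns, so that the displayed formula
  defines a countably additive \<open>m\<close> as soon as the sums exist.
\<close>

section \<open>Unordered sums\<close>

text \<open>Only finitely many rows are joined, one disjoint row at a time, so continuity of
  addition is enough.\<close>

lemma has_sum_Sigma_finite:
  fixes f :: "'i \<times> 'j \<Rightarrow> 'a::topological_comm_monoid_add"
  assumes "finite I" and "\<And>i. i \<in> I \<Longrightarrow> ((\<lambda>j. f (i, j)) has_sum g i) (B i)"
  shows "(f has_sum (\<Sum>i\<in>I. g i)) (Sigma I B)"
  using assms
proof (induction I rule: finite_induct)
  case empty
  then show ?case by simp
next
  case (insert i I)
  have "inj_on (Pair i) (B i)"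
    by (auto simp: inj_on_def)
  then have "(f has_sum g i) (Pair i ` B i)"
    using insert.prems[of i] by (simp add: has_sum_reindex o_def)
  moreover have "(f has_sum (\<Sum>i\<in>I. g i)) (Sigma I B)"
    using insert by auto
  moreover have "Pair i ` B i \<inter> Sigma I B = {}"
    using insert.hyps by auto
  ultimately have "(f has_sum (g i + (\<Sum>i\<in>I. g i))) (Pair i ` B i \<union> Sigma I B)"
    by (rule has_sum_Un_disjoint)
  moreover have "Pair i ` B i \<union> Sigma I B = Sigma (insert i I) B"
    by auto
  ultimately show ?case
    using insert.hyps by simp
qed

text \<open>A finite sum of row sums is a limit of finite sums of \<open>f\<close> over those rows.
  Once the latter lie in a closed neighbourhood of \<open>s\<close>, so does the limit. This is the
  step where regularity enters.\<close>

lemma has_sum_Sigma_regular: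
  fixes f :: "'i \<times> 'j \<Rightarrow> 'a::topological_comm_monoid_add"
  assumes regular: "neighbourhood_base_of closed (euclidean :: 'a topology)"
    and total: "(f has_sum s) (Sigma I B)"
    and rows: "\<And>i. i \<in> I \<Longrightarrow> ((\<lambda>j. f (i, j)) has_sum g i) (B i)"
  shows "(g has_sum s) I"
  unfolding has_sum_def
proof (rule topological_tendstoI)
  fix W :: "'a set"
  assume "open W" "s \<in> W"
  then obtain U V where UV: "open U" "closed V" "s \<in> U" "U \<subseteq> V" "V \<subseteq> W"
    using regular unfolding neighbourhood_base_of by (metis open_openin)
  have "eventually (\<lambda>J. sum f J \<in> U) (finite_subsets_at_top (Sigma I B))"
    using total UV unfolding has_sum_def by (blast dest: topological_tendstoD)
  then obtain J where J: "finite J" "J \<subseteq> Sigma I B"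
    and JU: "\<And>K. finite K \<Longrightarrow> J \<subseteq> K \<Longrightarrow> K \<subseteq> Sigma I B \<Longrightarrow> sum f K \<in> U"
    unfolding eventually_finite_subsets_at_top by metis
  \<comment> \<open>\<open>K\<close> has to contain every row that meets \<open>J\<close>, so that
    finite sets above \<open>J\<close> exist inside \<open>Sigma K B\<close>.\<close>
  have "sum g K \<in> W" if K: "finite K" "fst ` J \<subseteq> K" "K \<subseteq> I" for K
  proof -
    have "(f has_sum sum g K) (Sigma K B)"
      using K rows by (intro has_sum_Sigma_finite) auto
    then have lim: "(sum f \<longlongrightarrow> sum g K) (finite_subsets_at_top (Sigma K B))"
      by (simp add: has_sum_def)
    have "J \<subseteq> Sigma K B"
      using J K by force
    moreover have "sum f L \<in> V" if "finite L" "J \<subseteq> L" "L \<subseteq> Sigma K B" for L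
    proof -
      have "L \<subseteq> Sigma I B"
        using that K(3) by auto
      then show ?thesis
        using JU that UV(4) by auto
    qed
    ultimately have "eventually (\<lambda>L. sum f L \<in> V) (finite_subsets_at_top (Sigma K B))"
      unfolding eventually_finite_subsets_at_top
      using J(1) by (intro exI[of _ J]) simp
    \<comment> \<open>The partial sums lie in \<open>U\<close>, but only the closed set
      \<open>V\<close> is sure to keep their limit.\<close>
    then have "sum g K \<in> V"
      using Lim_in_closed_set[OF UV(2) _ _ lim] by simp
    then show ?thesis
      using UV by blast
  qed
  then show "eventually (\<lambda>K. sum g K \<in> W) (finite_subsets_at_top I)"
    unfolding eventually_finite_subsets_at_top
    using J by (intro exI[of _ "fst ` J"]) auto
qed

section \<open>The host\<close>

text \<open>The empty set and binary unions are themselves countable unions, which leaves two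
  conditions to check in each hull argument.\<close>

lemma sigma_ring_iff:
  "sigma_ring Q \<longleftrightarrow> (\<forall>A\<in>Q. \<forall>B\<in>Q. A - B \<in> Q) \<and> (\<forall>C. C \<subseteq> Q \<and> countable C \<longrightarrow> \<Union>C \<in> Q)"
    (is "_ \<longleftrightarrow> ?diff \<and> ?union")
proof
  assume R: "?diff \<and> ?union"
  have "{} \<in> Q"
    using R[THEN conjunct2, rule_format, of "{}"] by simp
  moreover have "A \<union> B \<in> Q" if "A \<in> Q" "B \<in> Q" for A B
    using R[THEN conjunct2, rule_format, of "{A, B}"] that by simp
  ultimately show "sigma_ring Q"
    using R by (simp add: sigma_ring_def ring_of_sets_iff)
qed (simp add: sigma_ring_def ring_of_sets_iff)

text \<open>A hull is merely an intersection of sigma-rings, so stability of sigma-rings under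
  intersections is what has to be shown.\<close>

lemma sigma_ring_host: "sigma_ring (host \<mu>)"
  unfolding host_def
proof (rule hull_in)
  fix T :: "'a set set set"
  assume T: "Ball T sigma_ring"
  show "sigma_ring (\<Inter>T)"
    unfolding sigma_ring_iff
  proof (intro conjI ballI allI impI InterI)
    fix A B Q
    assume "A \<in> \<Inter>T" "B \<in> \<Inter>T" "Q \<in> T"
    then show "A - B \<in> Q"
      using T unfolding sigma_ring_iff by simp
  next
    fix C Q
    assume "C \<subseteq> \<Inter>T \<and> countable C" "Q \<in> T"
    then have "C \<subseteq> Q" "countable C" "sigma_ring Q"
      using T by auto
    then show "\<Union>C \<in> Q"
      unfolding sigma_ring_iff by simp
  qed
qed

lemma host_Diff: "A \<in> host \<mu> \<Longrightarrow> B \<in> host \<mu> \<Longrightarrow> A - B \<in> host \<mu>"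
  and host_Union: "countable C \<Longrightarrow> C \<subseteq> host \<mu> \<Longrightarrow> \<Union>C \<in> host \<mu>"
  and host_Un: "A \<in> host \<mu> \<Longrightarrow> B \<in> host \<mu> \<Longrightarrow> A \<union> B \<in> host \<mu>"
  using sigma_ring_host[of \<mu>] by (simp_all add: sigma_ring_def ring_of_sets_iff)

lemma host_Int: "A \<in> host \<mu> \<Longrightarrow> B \<in> host \<mu> \<Longrightarrow> A \<inter> B \<in> host \<mu>"
  by (metis Diff_Diff_Int host_Diff)

lemma dom_subset_host: "dom \<mu> \<subseteq> host \<mu>"
  unfolding host_def by (rule hull_subset)

lemma host_eqI:
  assumes "dom \<mu> \<subseteq> dom \<nu>" "dom \<nu> \<subseteq> host \<mu>"
  shows "host \<nu> = host \<mu>"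
proof
  show "host \<nu> \<subseteq> host \<mu>"
    using assms(2) sigma_ring_host[of \<mu>] by (simp add: host_def[of \<nu>] hull_minimal)
  show "host \<mu> \<subseteq> host \<nu>"
    using assms(1) unfolding host_def by (rule hull_mono)
qed

lemma delta_ring_Diff: "delta_ring Q \<Longrightarrow> A \<in> Q \<Longrightarrow> B \<in> Q \<Longrightarrow> A - B \<in> Q"
  by (simp add: delta_ring_def ring_of_sets_iff)

text \<open>Complements relative to the bound \<open>B\<close> turn the union into an intersection.
  The empty family is separate because a delta-ring is closed only under nonempty
  intersections.\<close>

lemma delta_ring_Union_subset:
  assumes Q: "delta_ring Q" and "countable C" "C \<subseteq> Q" "B \<in> Q" "\<Union>C \<subseteq> B"
  shows "\<Union>C \<in> Q"
proof (cases "C = {}")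
  case True
  then show ?thesis
    using Q by (simp add: delta_ring_def ring_of_sets_iff)
next
  case False
  note diff = delta_ring_Diff[OF Q]
  have "(\<lambda>X. B - X) ` C \<subseteq> Q"
    using diff assms by blast
  then have "(\<Inter>X\<in>C. B - X) \<in> Q"
    using Q False assms(2) unfolding delta_ring_def by (simp del: INT_simps)
  then have "B - (\<Inter>X\<in>C. B - X) \<in> Q"
    using diff assms by blast
  moreover have "B - (\<Inter>X\<in>C. B - X) = \<Union>C"
    using assms(5) by auto
  ultimately show ?thesis by simp
qed

text \<open>The domain is an ideal of the host: the sets whose trace on every member of the domain
  stays in the domain form a sigma-ring containing the domain.\<close>

lemma host_Int_dom:
  assumes D: "delta_ring (dom \<mu>)" and A: "A \<in> host \<mu>" and B: "B \<in> dom \<mu>"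
  shows "A \<inter> B \<in> dom \<mu>"
proof -
  let ?Q = "{A. \<forall>B\<in>dom \<mu>. A \<inter> B \<in> dom \<mu>}"
  note diff = delta_ring_Diff[OF D]
  have "dom \<mu> \<subseteq> ?Q"
  proof (intro subsetI CollectI ballI)
    fix X B
    assume "X \<in> dom \<mu>" "B \<in> dom \<mu>"
    then have "X - (X - B) \<in> dom \<mu>"
      by (intro diff)
    then show "X \<inter> B \<in> dom \<mu>"
      by (simp add: Diff_Diff_Int)
  qed
  moreover have "sigma_ring ?Q"
    unfolding sigma_ring_iff
  proof (intro conjI ballI allI impI)
    fix X Y
    assume "X \<in> ?Q" "Y \<in> ?Q"
    moreover have "(X - Y) \<inter> B = X \<inter> B - Y \<inter> B" for B
      by blast
    ultimately show "X - Y \<in> ?Q"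
      using diff by simp
  next
    fix C
    assume C: "C \<subseteq> ?Q \<and> countable C"
    have "\<Union>C \<inter> B \<in> dom \<mu>" if "B \<in> dom \<mu>" for B
    proof -
      \<comment> \<open>All traces lie inside the one set \<open>B\<close>, which supplies the bound
        for the countable union.\<close>
      have "\<Union>((\<lambda>X. X \<inter> B) ` C) \<in> dom \<mu>"
        using C that by (intro delta_ring_Union_subset[OF D _ _ that]) blast+
      moreover have "\<Union>((\<lambda>X. X \<inter> B) ` C) = \<Union>C \<inter> B"
        by auto
      ultimately show ?thesis
        by simp
    qed
    then show "\<Union>C \<in> ?Q"
      by blast
  qed
  ultimately have "host \<mu> \<subseteq> ?Q"
    unfolding host_def by (rule hull_minimal)
  then show ?thesis
    using A B by blast
qed

text \<open>Sets covered by countably many members of the domain form a sigma-ring, hence exhaust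
  the host. A cover is then made disjoint and cut down to \<open>A\<close>.\<close>

lemma host_partition:
  assumes D: "delta_ring (dom \<mu>)" and A: "A \<in> host \<mu>"
  obtains G :: "nat \<Rightarrow> 'x set"
    where "range G \<subseteq> dom \<mu>" "disjoint_family G" "(\<Union>n. G n) = A"
proof -
  let ?Q = "{A. \<exists>C. C \<subseteq> dom \<mu> \<and> countable C \<and> A \<subseteq> \<Union>C}"
  have "dom \<mu> \<subseteq> ?Q"
  proof
    fix X
    assume "X \<in> dom \<mu>"
    then show "X \<in> ?Q"
      by (intro CollectI exI[of _ "{X}"]) auto
  qed
  moreover have "sigma_ring ?Q"
    unfolding sigma_ring_iff
  proof (intro conjI ballI allI impI)
    fix X Y
    assume "X \<in> ?Q"
    then show "X - Y \<in> ?Q"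
      by blast
  next
    fix C
    assume C: "C \<subseteq> ?Q \<and> countable C"
    then have "\<forall>X\<in>C. \<exists>K. K \<subseteq> dom \<mu> \<and> countable K \<and> X \<subseteq> \<Union>K"
      by blast
    then obtain c where c: "\<forall>X\<in>C. c X \<subseteq> dom \<mu> \<and> countable (c X) \<and> X \<subseteq> \<Union>(c X)"
      by (rule bchoice[THEN exE])
    have "countable (\<Union>(c ` C))"
      using C c by auto
    moreover have "\<Union>(c ` C) \<subseteq> dom \<mu>"
      using c by (simp add: UN_subset_iff)
    moreover have "\<Union>C \<subseteq> \<Union>(\<Union>(c ` C))"
    proof (rule Union_least)
      fix X
      assume "X \<in> C"
      then have "X \<subseteq> \<Union>(c X)" "c X \<subseteq> \<Union>(c ` C)"
        using c by auto
      then show "X \<subseteq> \<Union>(\<Union>(c ` C))"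
        by (meson Union_mono subset_trans)
    qed
    ultimately show "\<Union>C \<in> ?Q"
      by blast
  qed
  ultimately have "host \<mu> \<subseteq> ?Q"
    unfolding host_def by (rule hull_minimal)
  then have "A \<in> ?Q"
    using A by (rule subsetD)
  then obtain C where C: "C \<subseteq> dom \<mu>" "countable C" "A \<subseteq> \<Union>C"
    unfolding mem_Collect_eq by (elim exE conjE)
  have ring: "ring_of_sets UNIV (dom \<mu>)" and empty: "{} \<in> dom \<mu>"
    using D by (simp_all add: delta_ring_def ring_of_sets_iff)
  \<comment> \<open>Adding the empty set makes the cover nonempty, so that it can be enumerated by
    all of \<open>nat\<close>.\<close>
  let ?E = "from_nat_into (insert {} C)"
  have E: "range ?E = insert {} C"
    using C by (intro range_from_nat_into) auto
  have "range (disjointed ?E) \<subseteq> dom \<mu>"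
    using E C(1) empty by (intro ring_of_sets.range_disjointed_sets[OF ring]) simp
  then have dE: "disjointed ?E n \<in> dom \<mu>" for n
    by (simp add: image_subset_iff)
  show thesis
  proof
    show "range (\<lambda>n. A \<inter> disjointed ?E n) \<subseteq> dom \<mu>"
      using host_Int_dom[OF D A dE] by (simp add: image_subset_iff)
    show "disjoint_family (\<lambda>n. A \<inter> disjointed ?E n)"
      using disjoint_family_disjointed[of ?E] unfolding disjoint_family_on_def by blast
    have "(\<Union>n. disjointed ?E n) = \<Union>(insert {} C)"
      using E by (simp add: UN_disjointed_eq)
    then show "(\<Union>n. A \<inter> disjointed ?E n) = A"
      using C by auto
  qed
qed

section \<open>Premeasures\<close>

lemma premeasure_delta_ring: "premeasure \<mu> \<Longrightarrow> delta_ring (dom \<mu>)"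
  by (simp add: premeasure_def)

lemma premeasure_has_sum:
  fixes F :: "nat \<Rightarrow> 'x set"
  assumes "premeasure \<mu>" "(\<Union>i\<in>I. F i) \<in> dom \<mu>" "F ` I \<subseteq> dom \<mu>" "disjoint_family_on F I"
  shows "((\<lambda>i. the (\<mu> (F i))) has_sum the (\<mu> (\<Union>i\<in>I. F i))) I"
  using assms unfolding premeasure_def by blast

lemma disjoint_family_on_Int:
  "disjoint_family_on F I \<Longrightarrow> disjoint_family_on (\<lambda>i. B \<inter> F i) I"
  unfolding disjoint_family_on_def by blast

text \<open>A countably additive extension of \<open>\<mu>\<close> to the host subsets of
  \<open>A\<close>. The map \<open>m\<close> is total for convenience; its values on other sets are
  irrelevant.\<close>

definition local_extension ::
    "('x set \<rightharpoonup> 'a::{topological_comm_monoid_add, t2_space}) \<Rightarrow> 'x set \<Rightarrow> ('x set \<Rightarrow> 'a) \<Rightarrow> bool"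
  where "local_extension \<mu> A m \<longleftrightarrow>
    (\<forall>B\<in>dom \<mu>. B \<subseteq> A \<longrightarrow> m B = the (\<mu> B)) \<and>
    (\<forall>(I::nat set) F. F ` I \<subseteq> host \<mu> \<and> disjoint_family_on F I \<and> (\<Union>i\<in>I. F i) \<subseteq> A \<longrightarrow>
       ((\<lambda>i. m (F i)) has_sum m (\<Union>i\<in>I. F i)) I)"

lemma local_extension_eq:
  "local_extension \<mu> A m \<Longrightarrow> B \<in> dom \<mu> \<Longrightarrow> B \<subseteq> A \<Longrightarrow> m B = the (\<mu> B)"
  by (simp add: local_extension_def)

lemma local_extension_has_sum:
  fixes F :: "nat \<Rightarrow> 'x set"
  assumes "local_extension \<mu> A m" "F ` I \<subseteq> host \<mu>" "disjoint_family_on F I"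
    "(\<Union>i\<in>I. F i) \<subseteq> A"
  shows "((\<lambda>i. m (F i)) has_sum m (\<Union>i\<in>I. F i)) I"
  using assms unfolding local_extension_def by blast

lemma local_extension_subset:
  "local_extension \<mu> A m \<Longrightarrow> B \<subseteq> A \<Longrightarrow> local_extension \<mu> B m"
  unfolding local_extension_def by (meson subset_trans)

text \<open>Split \<open>B\<close> into countably many members of \<open>dom \<mu>\<close>. Both
  maps agree with \<open>\<mu>\<close> on the pieces, and limits in a Hausdorff space are
  unique.\<close>

lemma local_extension_unique:
  assumes D: "delta_ring (dom \<mu>)" and B: "B \<in> host \<mu>"
    and m: "local_extension \<mu> A m" "B \<subseteq> A" and m': "local_extension \<mu> A' m'" "B \<subseteq> A'"
  shows "m B = m' B"
proof -
  obtain G :: "nat \<Rightarrow> _" where G: "range G \<subseteq> dom \<mu>" "disjoint_family G" "(\<Union>n. G n) = B"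
    using host_partition[OF D B] .
  have sum: "((\<lambda>n. the (\<mu> (G n))) has_sum k B) UNIV" if k: "local_extension \<mu> K k" "B \<subseteq> K" for k K
  proof -
    have "((\<lambda>n. k (G n)) has_sum k B) UNIV"
      using local_extension_has_sum[OF k(1), of G UNIV] subset_trans[OF G(1) dom_subset_host] G(2,3) k(2)
      by simp
    moreover have "k (G n) = the (\<mu> (G n))" for n
    proof (rule local_extension_eq[OF k(1)])
      show "G n \<in> dom \<mu>"
        using G(1) by (simp add: image_subset_iff)
      show "G n \<subseteq> K"
        using G(3) k(2) by blast
    qed
    ultimately show ?thesis by simp
  qed
  show ?thesis
    using has_sum_unique[OF sum[OF m] sum[OF m']] .
qed

text \<open>Countable additivity for a family indexed by \<open>{0,1}\<close>.\<close>

lemma premeasure_Un: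
  assumes \<mu>: "premeasure \<mu>" and "A \<in> dom \<mu>" "B \<in> dom \<mu>" "A \<inter> B = {}" "A \<union> B \<in> dom \<mu>"
  shows "the (\<mu> (A \<union> B)) = the (\<mu> A) + the (\<mu> B)"
proof -
  let ?F = "\<lambda>n::nat. if n = 0 then A else B"
  have U: "(\<Union>n\<in>{0,1}. ?F n) = A \<union> B"
    by auto
  have "((\<lambda>n. the (\<mu> (?F n))) has_sum the (\<mu> (\<Union>n\<in>{0,1}. ?F n))) {0,1}"
    unfolding U using assms
    by (intro premeasure_has_sum[OF \<mu>, where F = ?F and I = "{0,1}", unfolded U])
      (simp_all add: disjoint_family_on_def Int_commute)
  then show ?thesis
    unfolding U by (simp add: has_sum_finite_iff)
qed

text \<open>Cutting along \<open>A\<close> assigns the overlap of \<open>A\<close> and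
  \<open>B\<close> to \<open>m\<close> alone; \<open>m'\<close> handles only what lies outside
  \<open>A\<close>.\<close>

lemma local_extension_Un:
  assumes \<mu>: "premeasure \<mu>" and A: "A \<in> host \<mu>" and B: "B \<in> host \<mu>"
    and m: "local_extension \<mu> A m" and m': "local_extension \<mu> B m'"
  shows "local_extension \<mu> (A \<union> B) (\<lambda>C. m (C \<inter> A) + m' (C - A))"
proof -
  note D = premeasure_delta_ring[OF \<mu>]
  have "m (C \<inter> A) + m' (C - A) = the (\<mu> C)" if C: "C \<in> dom \<mu>" "C \<subseteq> A \<union> B" for C
  proof -
    have 1: "C \<inter> A \<in> dom \<mu>"
      using host_Int_dom[OF D A C(1)] by (simp add: Int_commute)
    have 2: "C - A \<in> dom \<mu>"
      using delta_ring_Diff[OF D C(1) 1] by (simp add: Diff_Int)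
    have "the (\<mu> (C \<inter> A \<union> (C - A))) = the (\<mu> (C \<inter> A)) + the (\<mu> (C - A))"
      using 1 2 C by (intro premeasure_Un[OF \<mu>]) (auto simp: Int_Diff_Un)
    moreover have "C - A \<subseteq> B"
      using C by auto
    ultimately show ?thesis
      using local_extension_eq[OF m 1] local_extension_eq[OF m' 2] by (simp add: Int_Diff_Un)
  qed
  moreover have "((\<lambda>i. m (F i \<inter> A) + m' (F i - A)) has_sum
      m ((\<Union>i\<in>I. F i) \<inter> A) + m' ((\<Union>i\<in>I. F i) - A)) I"
    if F: "F ` I \<subseteq> host \<mu>" "disjoint_family_on F I" "(\<Union>i\<in>I. F i) \<subseteq> A \<union> B" for I :: "nat set" and F
  proof (rule has_sum_add)
    have "((\<lambda>i. m (F i \<inter> A)) has_sum m (\<Union>i\<in>I. F i \<inter> A)) I"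
      using F A by (intro local_extension_has_sum[OF m])
        (auto simp: disjoint_family_on_def intro!: host_Int)
    then show "((\<lambda>i. m (F i \<inter> A)) has_sum m ((\<Union>i\<in>I. F i) \<inter> A)) I"
      by simp
    have "((\<lambda>i. m' (F i - A)) has_sum m' (\<Union>i\<in>I. F i - A)) I"
      using F A by (intro local_extension_has_sum[OF m'])
        (auto simp: disjoint_family_on_def intro!: host_Diff)
    then show "((\<lambda>i. m' (F i - A)) has_sum m' ((\<Union>i\<in>I. F i) - A)) I"
      by simp
  qed
  ultimately show ?thesis
    by (simp add: local_extension_def)
qed

text \<open>\<open>dom \<nu>\<close> is an ideal of the common host, so it contains every host
  subset of \<open>A\<close>, and \<open>\<nu>\<close> itself serves as the extension.\<close>

lemma premeasure_local_extension:
  assumes \<nu>: "premeasure \<nu>" and sim: "\<nu> \<asymp> \<mu>" and A: "A \<in> dom \<nu>"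
  shows "local_extension \<mu> A (\<lambda>B. the (\<nu> B))"
proof -
  note D = premeasure_delta_ring[OF \<nu>]
  have host: "host \<mu> = host \<nu>"
    using sim by (simp add: similar_def)
  have sub: "B \<in> dom \<nu>" if "B \<in> host \<nu>" "B \<subseteq> A" for B
    using host_Int_dom[OF D that(1) A] that(2) by (simp add: Int_absorb2)
  have "the (\<nu> B) = the (\<mu> B)" if "B \<in> dom \<mu>" "B \<subseteq> A" for B
    using sim sub that dom_subset_host[of \<mu>] host unfolding similar_def by (metis IntI subsetD)
  moreover have "((\<lambda>i. the (\<nu> (F i))) has_sum the (\<nu> (\<Union>i\<in>I. F i))) I"
    if F: "F ` I \<subseteq> host \<mu>" "disjoint_family_on F I" "(\<Union>i\<in>I. F i) \<subseteq> A" for I :: "nat set" and F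
  proof (rule premeasure_has_sum[OF \<nu> _ _ F(2)])
    have "(\<Union>i\<in>I. F i) \<in> host \<nu>"
      using F host by (intro host_Union) auto
    then show "(\<Union>i\<in>I. F i) \<in> dom \<nu>"
      using F by (intro sub)
    show "F ` I \<subseteq> dom \<nu>"
    proof (rule image_subsetI)
      fix i
      assume "i \<in> I"
      then show "F i \<in> dom \<nu>"
        using F host by (intro sub) auto
    qed
  qed
  ultimately show ?thesis
    by (simp add: local_extension_def)
qed

section \<open>The largest similar premeasure\<close>

text \<open>The candidate for the measure similar to \<open>\<mu>\<close>. For a premeasure,
  \<open>local_extension_unique\<close> makes the value independent of the choice of
  \<open>m\<close>.\<close>

definition max_extension ::
    "('x set \<rightharpoonup> 'a::{topological_comm_monoid_add, t2_space}) \<Rightarrow> 'x set \<rightharpoonup> 'a"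
  where "max_extension \<mu> A =
    (if A \<in> host \<mu> \<and> (\<exists>m. local_extension \<mu> A m)
     then Some ((SOME m. local_extension \<mu> A m) A) else None)"

lemma dom_max_extension: "dom (max_extension \<mu>) = {A \<in> host \<mu>. \<exists>m. local_extension \<mu> A m}"
  by (auto simp: max_extension_def split: if_splits)

lemma dom_max_extension_subset: "dom (max_extension \<mu>) \<subseteq> host \<mu>"
  unfolding dom_max_extension by (rule Collect_restrict)

text \<open>The definition chooses a new map for each \<open>B\<close>; by uniqueness one map for
  \<open>A\<close> gives the values on all host subsets of \<open>A\<close>. Additivity can thus be
  read off from a single \<open>m\<close>.\<close>

lemma max_extension_eq:
  assumes D: "delta_ring (dom \<mu>)" and m: "local_extension \<mu> A m" and B: "B \<in> host \<mu>" "B \<subseteq> A"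
  shows "max_extension \<mu> B = Some (m B)"
proof -
  have mB: "local_extension \<mu> B m"
    using local_extension_subset[OF m B(2)] .
  then have "local_extension \<mu> B (SOME m. local_extension \<mu> B m)"
    by (rule someI[of "local_extension \<mu> B"])
  then have "(SOME m. local_extension \<mu> B m) B = m B"
    by (rule local_extension_unique[OF D B(1) _ order_refl mB order_refl])
  then show ?thesis
    using B mB by (auto simp: max_extension_def)
qed

text \<open>This is the maximality; the case \<open>\<nu> = \<mu>\<close> shows that
  \<open>\<mu>\<close> itself is extended.\<close>

lemma similar_map_le_max_extension:
  assumes \<mu>: "premeasure \<mu>" and \<nu>: "premeasure \<nu>" and sim: "\<nu> \<asymp> \<mu>"
  shows "\<nu> \<subseteq>\<^sub>m max_extension \<mu>"
  unfolding map_le_def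
proof
  fix A
  assume A: "A \<in> dom \<nu>"
  then have "A \<in> host \<mu>"
    using sim dom_subset_host[of \<nu>] by (auto simp: similar_def)
  then have "max_extension \<mu> A = Some (the (\<nu> A))"
    using premeasure_local_extension[OF \<nu> sim A] premeasure_delta_ring[OF \<mu>]
    by (intro max_extension_eq) auto
  then show "\<nu> A = max_extension \<mu> A"
    using A by auto
qed

lemma similar_refl: "\<mu> \<asymp> \<mu>"
  by (simp add: similar_def)

lemma similar_max_extension:
  assumes "premeasure \<mu>"
  shows "max_extension \<mu> \<asymp> \<mu>"
proof -
  have le: "\<mu> \<subseteq>\<^sub>m max_extension \<mu>"
    using similar_map_le_max_extension[OF assms assms similar_refl] .
  have "host (max_extension \<mu>) = host \<mu>"
    by (rule host_eqI[OF map_le_implies_dom_le[OF le] dom_max_extension_subset])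
  then show ?thesis
    using le by (simp add: similar_def map_le_def)
qed

text \<open>The domain is closed under host subsets and finite unions, hence a delta-ring;
  additivity on a partition of \<open>A\<close> is that of one local extension at
  \<open>A\<close>.\<close>

lemma premeasure_max_extension:
  assumes \<mu>: "premeasure \<mu>"
  shows "premeasure (max_extension \<mu>)"
proof -
  note D = premeasure_delta_ring[OF \<mu>]
  let ?M = "dom (max_extension \<mu>)"
  have sub: "B \<in> ?M" if "A \<in> ?M" "B \<in> host \<mu>" "B \<subseteq> A" for A B
  proof -
    obtain m where "local_extension \<mu> A m"
      using \<open>A \<in> ?M\<close> unfolding dom_max_extension by blast
    then have "local_extension \<mu> B m"
      using \<open>B \<subseteq> A\<close> by (rule local_extension_subset)
    then show ?thesis
      using \<open>B \<in> host \<mu>\<close> unfolding dom_max_extension mem_Collect_eq by (intro conjI exI)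
  qed
  have un: "A \<union> B \<in> ?M" if "A \<in> ?M" "B \<in> ?M" for A B
  proof -
    obtain m m' where "A \<in> host \<mu>" "local_extension \<mu> A m" "B \<in> host \<mu>" "local_extension \<mu> B m'"
      using \<open>A \<in> ?M\<close> \<open>B \<in> ?M\<close> unfolding dom_max_extension by blast
    then show ?thesis
      using local_extension_Un[OF \<mu>, of A B m m'] host_Un[of A \<mu> B]
      unfolding dom_max_extension mem_Collect_eq by (intro conjI exI)
  qed
  note host = dom_max_extension_subset[of \<mu>]
  have "dom \<mu> \<subseteq> ?M"
    using similar_map_le_max_extension[OF \<mu> \<mu> similar_refl] by (rule map_le_implies_dom_le)
  moreover have "{} \<in> dom \<mu>"
    using D by (simp add: delta_ring_def ring_of_sets_iff)
  ultimately have "{} \<in> ?M"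
    by (rule subsetD)
  moreover have "A - B \<in> ?M" if "A \<in> ?M" "B \<in> ?M" for A B
    using host_Diff[OF subsetD[OF host that(1)] subsetD[OF host that(2)]]
    by (rule sub[OF that(1)]) (rule Diff_subset)
  moreover have "\<Inter>C \<in> ?M" if C: "C \<subseteq> ?M" "C \<noteq> {}" "countable C" for C
  proof -
    obtain A where A: "A \<in> C"
      using C by blast
    have CH: "B \<in> host \<mu>" if "B \<in> C" for B
      using host C(1) that by (meson subsetD)
    \<comment> \<open>Relative to a fixed member \<open>A\<close> of \<open>C\<close>, the
      intersection becomes \<open>A\<close> minus a countable union. So it is a host subset of
      \<open>A\<close>.\<close>
    have "\<Union>((\<lambda>B. A - B) ` C) \<in> host \<mu>"
      using C(3) host_Diff[OF CH[OF A] CH] by (intro host_Union) auto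
    then have "A - \<Union>((\<lambda>B. A - B) ` C) \<in> host \<mu>"
      using CH[OF A] by (intro host_Diff)
    moreover have "A - \<Union>((\<lambda>B. A - B) ` C) = \<Inter>C"
      using A by blast
    ultimately show ?thesis
      using A by (intro sub[OF subsetD[OF C(1) A]]) (simp_all add: Inter_lower)
  qed
  ultimately have "delta_ring ?M"
    using un by (simp add: delta_ring_def ring_of_sets_iff)
  moreover have "((\<lambda>i. the (max_extension \<mu> (F i))) has_sum the (max_extension \<mu> A)) I"
    if A: "A \<in> ?M" and F: "F ` I \<subseteq> ?M" "disjoint_family_on F I" "(\<Union>i\<in>I. F i) = A"
    for A and I :: "nat set" and F
  proof -
    obtain m where m: "local_extension \<mu> A m" and AH: "A \<in> host \<mu>"
      using A by (auto simp: dom_max_extension)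
    have eq: "the (max_extension \<mu> B) = m B" if "B \<in> host \<mu>" "B \<subseteq> A" for B
      using max_extension_eq[OF D m that] by simp
    have "((\<lambda>i. m (F i)) has_sum m A) I"
      using local_extension_has_sum[OF m, of F I] F host by auto
    moreover have "the (max_extension \<mu> (F i)) = m (F i)" if "i \<in> I" for i
      using that F host by (intro eq) auto
    ultimately show ?thesis
      unfolding eq[OF AH order_refl] by (simp cong: has_sum_cong)
  qed
  ultimately show ?thesis
    unfolding premeasure_def by blast
qed

lemma max_measure_max_extension:
  fixes \<mu> :: "'x set \<rightharpoonup> 'a::{topological_comm_monoid_add, t2_space}"
  assumes \<mu>: "premeasure \<mu>"
  shows "max_measure (max_extension \<mu>)"
  unfolding max_measure_def
proof (intro conjI allI impI)
  show "premeasure (max_extension \<mu>)"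
    using premeasure_max_extension[OF \<mu>] .
  fix \<nu> :: "'x set \<rightharpoonup> 'a"
  assume \<nu>: "premeasure \<nu> \<and> \<nu> \<asymp> max_extension \<mu>"
  have le: "\<mu> \<subseteq>\<^sub>m max_extension \<mu>"
    using similar_map_le_max_extension[OF \<mu> \<mu> similar_refl] .
  \<comment> \<open>Similarity passes from \<open>max_extension \<mu>\<close> to
    \<open>\<mu>\<close> because the former is defined wherever \<open>\<mu>\<close> is, so values
    can be compared through it.\<close>
  have "\<nu> A = \<mu> A" if "A \<in> dom \<nu>" "A \<in> dom \<mu>" for A
  proof -
    have "\<nu> A = max_extension \<mu> A"
      using \<nu> that subsetD[OF map_le_implies_dom_le[OF le]] by (simp add: similar_def)
    also have "\<dots> = \<mu> A"
      using le that(2) by (simp add: map_le_def)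
    finally show ?thesis .
  qed
  then have "\<nu> \<asymp> \<mu>"
    using \<nu> similar_max_extension[OF \<mu>] by (simp add: similar_def)
  then show "\<nu> \<subseteq>\<^sub>m max_extension \<mu>"
    using \<nu> by (intro similar_map_le_max_extension[OF \<mu>]) auto
qed

text \<open>Uniqueness comes from playing two maximalities against each other: a similar measure
  lies below \<open>max_extension \<mu>\<close>, which in turn is a premeasure similar to
  it.\<close>

lemma measure_gen_eq_max_extension:
  assumes \<mu>: "premeasure \<mu>"
  shows "measure_gen \<mu> = max_extension \<mu>"
  unfolding measure_gen_def
proof (rule the_equality)
  show "max_measure (max_extension \<mu>) \<and> max_extension \<mu> \<asymp> \<mu>"
    using max_measure_max_extension[OF \<mu>] similar_max_extension[OF \<mu>] ..
  fix \<nu>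
  assume \<nu>: "max_measure \<nu> \<and> \<nu> \<asymp> \<mu>"
  then have le: "\<nu> \<subseteq>\<^sub>m max_extension \<mu>"
    by (intro similar_map_le_max_extension[OF \<mu>]) (auto simp: max_measure_def)
  have "max_extension \<mu> \<asymp> \<nu>"
    using le \<nu> similar_max_extension[OF \<mu>] unfolding similar_def map_le_def by auto
  then have "max_extension \<mu> \<subseteq>\<^sub>m \<nu>"
    using \<nu> premeasure_max_extension[OF \<mu>] by (auto simp: max_measure_def)
  then show "\<nu> = max_extension \<mu>"
    using le by (rule map_le_antisym[rotated])
qed

lemma Sigma_dom_eq:
  "premeasure \<mu> \<Longrightarrow> Sigma_dom \<mu> = {A \<in> host \<mu>. \<exists>m. local_extension \<mu> A m}"
  by (simp add: Sigma_dom_def measure_gen_eq_max_extension dom_max_extension)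

section \<open>Summability inside a set\<close>

text \<open>The union of the family need not belong to \<open>dom \<mu>\<close>, but it is a host
  subset of \<open>A\<close>, so \<open>m\<close> supplies the sum.\<close>

lemma Sigma_dom_subset_L_dom:
  assumes \<mu>: "premeasure \<mu>"
  shows "Sigma_dom \<mu> \<subseteq> L_dom \<mu>"
proof
  fix A
  assume "A \<in> Sigma_dom \<mu>"
  then obtain m where A: "A \<in> host \<mu>" and m: "local_extension \<mu> A m"
    by (auto simp: Sigma_dom_eq[OF \<mu>])
  have "(\<lambda>i. the (\<mu> (F i))) summable_on I"
    if F: "F ` I \<subseteq> dom \<mu>" "disjoint_family_on F I" "\<forall>i\<in>I. F i \<subseteq> A" for I :: "nat set" and F
  proof -
    have "((\<lambda>i. m (F i)) has_sum m (\<Union>i\<in>I. F i)) I"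
      using F subset_trans[OF F(1) dom_subset_host]
      by (intro local_extension_has_sum[OF m]) (simp_all add: UN_subset_iff)
    moreover have "m (F i) = the (\<mu> (F i))" if "i \<in> I" for i
      using F that by (intro local_extension_eq[OF m]) (simp_all add: image_subset_iff)
    ultimately show ?thesis
      by (auto simp: summable_on_def cong: has_sum_cong)
  qed
  then show "A \<in> L_dom \<mu>"
    using A by (auto simp: L_dom_def)
qed

text \<open>Transfers the defining property of \<open>L_dom\<close> from index sets in
  \<open>nat\<close> to any countable index set; families indexed by pairs are needed below.\<close>

lemma L_dom_summable:
  fixes F :: "'k \<Rightarrow> 'x set"
  assumes A: "A \<in> L_dom \<mu>" and K: "countable K"
    and F: "F ` K \<subseteq> dom \<mu>" "disjoint_family_on F K" "\<And>k. k \<in> K \<Longrightarrow> F k \<subseteq> A"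
  shows "(\<lambda>k. the (\<mu> (F k))) summable_on K"
proof -
  let ?e = "to_nat_on K" and ?d = "from_nat_into K"
  have inj: "inj_on ?e K"
    using K by (rule inj_on_to_nat_on)
  have de: "?d (?e k) = k" if "k \<in> K" for k
    using K that by simp
  have "(\<lambda>n. the (\<mu> (F (?d n)))) summable_on (?e ` K)"
  proof -
    have "(\<lambda>n. F (?d n)) ` (?e ` K) \<subseteq> dom \<mu>"
      using F(1) de by (simp add: image_subset_iff)
    moreover have "disjoint_family_on (\<lambda>n. F (?d n)) (?e ` K)"
      using F(2) de by (clarsimp simp: disjoint_family_on_def) metis
    moreover have "\<forall>n\<in>?e ` K. F (?d n) \<subseteq> A"
      using F(3) de by simp
    ultimately show ?thesis
      using A unfolding L_dom_def by simp
  qed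
  then have "((\<lambda>n. the (\<mu> (F (?d n)))) \<circ> ?e) summable_on K"
    by (simp add: summable_on_reindex[OF inj])
  then show ?thesis
    using de by (simp cong: summable_on_cong)
qed

text \<open>For a disjoint family \<open>F\<close>, the sets \<open>F i \<inter> G n\<close> form a
  summable double family. Its row sums are the values at the \<open>F i\<close>; its column sums are
  the terms defining the value at the union.\<close>

lemma local_extension_of_summable:
  fixes \<mu> :: "'x set \<rightharpoonup> 'a::{topological_comm_monoid_add, t2_space}"
  assumes regular: "neighbourhood_base_of closed (euclidean :: 'a topology)"
    and \<mu>: "premeasure \<mu>" and A: "A \<in> L_dom \<mu>"
    and G: "range G \<subseteq> dom \<mu>" "disjoint_family G" "(\<Union>n::nat. G n) = A"
  shows "local_extension \<mu> A (\<lambda>B. \<Sum>\<^sub>\<infinity>n. the (\<mu> (B \<inter> G n)))"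
proof -
  note D = premeasure_delta_ring[OF \<mu>]
  have part: "B \<inter> G n \<in> dom \<mu>" if "B \<in> host \<mu>" for B n
    using host_Int_dom[OF D that] G(1) by (simp add: image_subset_iff)
  have disjG: "G n \<inter> G n' = {}" if "n \<noteq> n'" for n n'
    using G(2) that by (auto simp: disjoint_family_on_def)
  \<comment> \<open>\<open>infsum\<close> defaults to 0 on families that are not summable, so
    summability has to be secured before the formula means anything.\<close>
  have sum: "((\<lambda>n. the (\<mu> (B \<inter> G n))) has_sum (\<Sum>\<^sub>\<infinity>n. the (\<mu> (B \<inter> G n)))) UNIV"
    if B: "B \<in> host \<mu>" for B
  proof (rule has_sum_infsum, rule L_dom_summable[OF A])
    show "disjoint_family (\<lambda>n. B \<inter> G n)"
      using G(2) by (rule disjoint_family_on_Int)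
  qed (use B G part in auto)
  have "(\<Sum>\<^sub>\<infinity>n. the (\<mu> (B \<inter> G n))) = the (\<mu> B)" if B: "B \<in> dom \<mu>" "B \<subseteq> A" for B
  proof (rule infsumI)
    have BG: "(\<Union>n. B \<inter> G n) = B"
      using B G by auto
    have "range (\<lambda>n. B \<inter> G n) \<subseteq> dom \<mu>"
      using part subsetD[OF dom_subset_host B(1)] by (simp add: image_subset_iff)
    then show "((\<lambda>n. the (\<mu> (B \<inter> G n))) has_sum the (\<mu> B)) UNIV"
      using premeasure_has_sum[OF \<mu>, where F = "\<lambda>n. B \<inter> G n" and I = UNIV] B(1)
        disjoint_family_on_Int[OF G(2)]
      unfolding BG by simp
  qed
  moreover have "((\<lambda>i. \<Sum>\<^sub>\<infinity>n. the (\<mu> (F i \<inter> G n))) has_sum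
      (\<Sum>\<^sub>\<infinity>n. the (\<mu> ((\<Union>i\<in>I. F i) \<inter> G n)))) I"
    if F: "F ` I \<subseteq> host \<mu>" "disjoint_family_on F I" "(\<Union>i\<in>I. F i) \<subseteq> A"
    for I :: "nat set" and F
  proof -
    let ?f = "\<lambda>(i, n). the (\<mu> (F i \<inter> G n))"
    have U: "(\<Union>i\<in>I. F i) \<in> host \<mu>"
      using F by (intro host_Union) auto
    have disjF: "F i \<inter> F i' = {}" if "i \<in> I" "i' \<in> I" "i \<noteq> i'" for i i'
      using F(2) that by (auto simp: disjoint_family_on_def)
    have "(\<lambda>k. the (\<mu> (case k of (i, n) \<Rightarrow> F i \<inter> G n))) summable_on (I \<times> UNIV)"
    proof (rule L_dom_summable[OF A])
      show "(\<lambda>(i, n). F i \<inter> G n) ` (I \<times> UNIV) \<subseteq> dom \<mu>"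
        using F(1) part by fastforce
      show "disjoint_family_on (\<lambda>(i, n). F i \<inter> G n) (I \<times> UNIV)"
        unfolding disjoint_family_on_def
      proof (intro ballI impI)
        fix k k' :: "nat \<times> nat"
        assume "k \<in> I \<times> UNIV" "k' \<in> I \<times> UNIV" "k \<noteq> k'"
        then have "F (fst k) \<inter> F (fst k') = {} \<or> G (snd k) \<inter> G (snd k') = {}"
          using disjF[of "fst k" "fst k'"] disjG[of "snd k" "snd k'"] by (auto simp: prod_eq_iff)
        then show "(case k of (i, n) \<Rightarrow> F i \<inter> G n) \<inter> (case k' of (i, n) \<Rightarrow> F i \<inter> G n) = {}"
          by (auto simp: case_prod_unfold)
      qed
    qed (use G in auto)
    then obtain s where s: "(?f has_sum s) (I \<times> UNIV)"
      by (auto simp: summable_on_def case_prod_unfold)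
    have rows: "((\<lambda>i. \<Sum>\<^sub>\<infinity>n. the (\<mu> (F i \<inter> G n))) has_sum s) I"
      using F sum by (intro has_sum_Sigma_regular[OF regular s]) auto
    \<comment> \<open>The same total \<open>s\<close>, now arranged for summation by
      columns.\<close>
    have s': "((\<lambda>(n, i). ?f (i, n)) has_sum s) (UNIV \<times> I)"
      using s by (subst (asm) has_sum_swap)
    have "((\<lambda>n. the (\<mu> ((\<Union>i\<in>I. F i) \<inter> G n))) has_sum s) UNIV"
    proof (rule has_sum_Sigma_regular[OF regular s'])
      fix n
      \<comment> \<open>Within a column all sets lie in \<open>G n\<close>, so their union is in
        \<open>dom \<mu>\<close> and additivity of \<open>\<mu>\<close> gives the column
        sum.\<close>
      have "(\<Union>i\<in>I. F i \<inter> G n) = (\<Union>i\<in>I. F i) \<inter> G n"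
        by blast
      moreover have "disjoint_family_on (\<lambda>i. F i \<inter> G n) I"
        using disjF unfolding disjoint_family_on_def by blast
      ultimately show "((\<lambda>i. case (n, i) of (n, i) \<Rightarrow> ?f (i, n)) has_sum
          the (\<mu> ((\<Union>i\<in>I. F i) \<inter> G n))) I"
        using premeasure_has_sum[OF \<mu>, where F = "\<lambda>i. F i \<inter> G n" and I = I] part U F(1)
        by (auto simp: image_subset_iff)
    qed
    then show ?thesis
      using rows has_sum_unique[OF sum[OF U]] by simp
  qed
  ultimately show ?thesis
    by (simp add: local_extension_def)
qed

theorem theorem6p2:
  fixes \<mu> :: "'x set \<rightharpoonup> 'a::{topological_comm_monoid_add, t2_space}"
  assumes "premeasure \<mu>"
  shows "Sigma_dom \<mu> \<subseteq> L_dom \<mu> \<and>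
    (neighbourhood_base_of closed (euclidean :: 'a topology) \<longrightarrow> Sigma_dom \<mu> = L_dom \<mu>)"
proof (intro conjI impI subset_antisym)
  assume regular: "neighbourhood_base_of closed (euclidean :: 'a topology)"
  show "L_dom \<mu> \<subseteq> Sigma_dom \<mu>"
  proof
    fix A
    assume A: "A \<in> L_dom \<mu>"
    then have "A \<in> host \<mu>"
      by (simp add: L_dom_def)
    \<comment> \<open>Any partition of \<open>A\<close> into members of \<open>dom \<mu>\<close>
      yields a witness for the local extension.\<close>
    moreover obtain G :: "nat \<Rightarrow> 'x set"
      where "range G \<subseteq> dom \<mu>" "disjoint_family G" "(\<Union>n. G n) = A"
      using host_partition[OF premeasure_delta_ring[OF assms] \<open>A \<in> host \<mu>\<close>] .
    ultimately show "A \<in> Sigma_dom \<mu>"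
      using local_extension_of_summable[OF regular assms A] Sigma_dom_eq[OF assms] by blast
  qed
qed (rule Sigma_dom_subset_L_dom[OF assms])+

end
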